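(* Let $d, n \geq 1$ be integers and let $u_1, \dots, u_n$ be unit vectors in $\mathbb{R}^d$. Then their absolute convex hull, that is, the convex hull of $\{\pm u_1, \dots, \pm u_n\}$, does not contain the ball \[ \left(\frac{\sqrt{n}}{d} + \varepsilon\right) \mathbf{B}^d \] for any $\varepsilon > 0$.
   Context: $\mathbf{B}^d = \{x \in \mathbb{R}^d : |x| \leq 1\}$ denotes the standard closed Euclidean unit ball centered at the origin of $\mathbb{R}^d$, and for $r>0$, $r\mathbf{B}^d = \{r x : x \in \mathbf{B}^d\}$. Unit vectors are taken with respect to the Euclidean norm. The vectors $u_1,\dots,u_n$ are not assumed distinct. *)

theory Defs
  imports "HOL-Analysis.Analysis"
begin

end

theory Submission
  imports Defs
begin

text \<open>
  By duality it is enough to find a vector \<open>y\<close> of length at least \<open>d / sqrt n\<close> with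
  \<open>\<bar>u i \<bullet> y\<bar> \<le> 1\<close> for all \<open>i\<close>: the half-space \<open>{x. y \<bullet> x \<le> 1}\<close> then contains the absolute convex
  hull, but no ball about the origin of radius larger than \<open>1 / norm y\<close>.

  The vector comes from a combinatorial form of Vaaler's theorem on cube sections, due to Ball and
  Prodromou. Let \<open>Q = \<Sum>i. u i \<otimes> u i\<close>, which has trace \<open>n\<close>. If \<open>Q\<close> is singular, a kernel vector
  is orthogonal to every \<open>u i\<close> and can be scaled at will. Otherwise the vectors \<open>v i = Q\<^sup>-\<^sup>1\<^sup>/\<^sup>2 (u i)\<close>
  form a Parseval frame, \<open>\<Sum>i. (v i \<bullet> z)\<^sup>2 = (norm z)\<^sup>2\<close>. For such a frame and every positive
  semidefinite form \<open>A\<close>, some \<open>z\<close> in the polytope \<open>P = {z. \<forall>i. \<bar>v i \<bullet> z\<bar> \<le> 1}\<close> has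
  \<open>A z \<bullet> z \<ge> trace A\<close> (lemma \<open>parseval_frame_slabs\<close>). With \<open>A = Q\<^sup>-\<^sup>1\<close> and \<open>y = Q\<^sup>-\<^sup>1\<^sup>/\<^sup>2 z\<close> this
  says \<open>(norm y)\<^sup>2 \<ge> trace (Q\<^sup>-\<^sup>1)\<close>, and the Cauchy-Schwarz inequality bounds the trace below by
  \<open>d\<^sup>2 / trace Q = d\<^sup>2 / n\<close>.

  The statement about forms is proved by induction on the dimension. If \<open>m\<close> is the least eigenvalue
  of \<open>A\<close>, then \<open>A - m I\<close> is positive semidefinite and has a kernel, so the induction hypothesis on
  the orthogonal complement of a kernel vector gives a point of \<open>P\<close> that works for \<open>A - m I\<close>. A convex
  function on a polytope is maximal at an extreme point, so that point may be replaced by an extreme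
  point \<open>z\<close> of \<open>P\<close>. At \<open>z\<close> at least \<open>d\<close> of the slab constraints are tight, and the frame identity turns
  this into \<open>(norm z)\<^sup>2 \<ge> d\<close>, which is exactly what the part \<open>m I\<close> needs.
\<close>

section \<open>Orthonormal sequences and the spectral theorem\<close>

definition orthonormal_upto :: "nat \<Rightarrow> (nat \<Rightarrow> 'a::euclidean_space) \<Rightarrow> bool" where
  "orthonormal_upto k e \<longleftrightarrow> (\<forall>i<k. \<forall>j<k. e i \<bullet> e j = (if i = j then 1 else 0))"

lemma orthonormal_upto_inner:
  "orthonormal_upto k e \<Longrightarrow> i < k \<Longrightarrow> j < k \<Longrightarrow> e i \<bullet> e j = (if i = j then 1 else 0)"
  by (simp add: orthonormal_upto_def)

lemma inner_orthonormal_sum: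
  assumes "orthonormal_upto k e" "j < k"
  shows "(\<Sum>i<k. c i *\<^sub>R e i) \<bullet> e j = c j"
proof -
  have "(\<Sum>i<k. c i *\<^sub>R e i) \<bullet> e j = (\<Sum>i<k. if i = j then c i else 0)"
    unfolding inner_sum_left
    by (rule sum.cong) (auto simp: orthonormal_upto_inner[OF assms(1) _ assms(2)])
  then show ?thesis
    using assms(2) by simp
qed

lemma orthonormal_expansion:
  fixes x :: "'a::euclidean_space"
  assumes e: "orthonormal_upto DIM('a) e"
  shows "x = (\<Sum>j<DIM('a). (x \<bullet> e j) *\<^sub>R e j)"
proof -
  let ?B = "e ` {..<DIM('a)}"
  have inj: "inj_on e {..<DIM('a)}"
  proof (rule inj_onI)
    fix i j assume ij: "i \<in> {..<DIM('a)}" "j \<in> {..<DIM('a)}" "e i = e j"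
    have "e i \<bullet> e j = 1"
      using ij orthonormal_upto_inner[OF e, of i i] by auto
    then show "i = j"
      using ij orthonormal_upto_inner[OF e, of i j] by (auto split: if_splits)
  qed
  have pw: "pairwise orthogonal ?B"
    by (auto simp: pairwise_def orthogonal_def orthonormal_upto_inner[OF e])
  have unit: "norm b = 1" if "b \<in> ?B" for b
    using that orthonormal_upto_inner[OF e] by (auto simp: norm_eq_1)
  have "independent ?B"
    using unit by (intro pairwise_orthogonal_independent[OF pw]) force
  then have "x \<in> span ?B"
    using card_ge_dim_independent[of ?B UNIV] inj by (auto simp: card_image)
  then have "(\<Sum>b\<in>?B. (x \<bullet> b) *\<^sub>R b) = x"
    by (intro orthonormal_basis_expand[OF pw unit]) auto
  moreover have "(\<Sum>b\<in>?B. (x \<bullet> b) *\<^sub>R b) = (\<Sum>j<DIM('a). (x \<bullet> e j) *\<^sub>R e j)"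
    by (simp add: sum.reindex[OF inj])
  ultimately show ?thesis
    by simp
qed

lemma orthonormal_norm_sum:
  fixes e :: "nat \<Rightarrow> 'a::euclidean_space"
  assumes "orthonormal_upto k e"
  shows "(norm (\<Sum>j<k. c j *\<^sub>R e j))\<^sup>2 = (\<Sum>j<k. (c j)\<^sup>2)"
proof -
  let ?x = "\<Sum>j<k. c j *\<^sub>R e j"
  have "?x \<bullet> ?x = (\<Sum>l<k. ?x \<bullet> (c l *\<^sub>R e l))"
    by (rule inner_sum_right)
  also have "\<dots> = (\<Sum>l<k. c l * c l)"
    by (rule sum.cong) (simp_all add: inner_orthonormal_sum[OF assms])
  finally show ?thesis
    by (simp add: dot_square_norm power2_eq_square)
qed

lemma orthonormal_parseval:
  fixes x :: "'a::euclidean_space"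
  assumes "orthonormal_upto DIM('a) e"
  shows "(norm x)\<^sup>2 = (\<Sum>j<DIM('a). (x \<bullet> e j)\<^sup>2)"
  using orthonormal_norm_sum[OF assms, of "\<lambda>j. x \<bullet> e j"] orthonormal_expansion[OF assms, of x]
  by metis

lemma exists_orthogonal_to_few:
  fixes S :: "'a::euclidean_space set"
  assumes "finite S" "card S < DIM('a)"
  obtains w where "w \<noteq> 0" "\<And>s. s \<in> S \<Longrightarrow> s \<bullet> w = 0"
proof -
  have "dim S < DIM('a)"
    using dim_le_card'[OF assms(1)] assms(2) by simp
  then obtain w where "w \<noteq> 0" "\<And>y. y \<in> span S \<Longrightarrow> orthogonal w y"
    using orthogonal_to_subspace_exists by blast
  then show thesis
    using that[of w] by (auto simp: orthogonal_def inner_commute span_base)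
qed

text \<open>
  The first-order condition for a minimum of the Rayleigh quotient: moving from \<open>x\<close> in the direction
  of the residual \<open>g = f x - l *\<^sub>R x\<close> changes the nonnegative form \<open>f y \<bullet> y - l * (y \<bullet> y)\<close> by
  \<open>2 * t * (g \<bullet> g) + O(t\<^sup>2)\<close>, which is negative for small \<open>t < 0\<close> unless \<open>g = 0\<close>.
\<close>

lemma minimizer_is_eigenvector:
  fixes f :: "'a::euclidean_space \<Rightarrow> 'a"
  assumes f: "linear f" and sym: "\<And>x y. f x \<bullet> y = x \<bullet> f y"
    and S: "subspace S" and inv: "\<And>x. x \<in> S \<Longrightarrow> f x \<in> S"
    and x: "x \<in> S" "f x \<bullet> x = l * (x \<bullet> x)"
    and min: "\<And>y. y \<in> S \<Longrightarrow> l * (y \<bullet> y) \<le> f y \<bullet> y"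
  shows "f x = l *\<^sub>R x"
proof (rule ccontr)
  assume ne: "f x \<noteq> l *\<^sub>R x"
  define g where "g = f x - l *\<^sub>R x"
  define h where "h = f g \<bullet> g - l * (g \<bullet> g)"
  have gS: "g \<in> S"
    unfolding g_def using S inv[OF x(1)] x(1) by (simp add: subspace_diff subspace_scale)
  have pos: "g \<bullet> g > 0"
    using ne by (simp add: g_def)
  have q: "0 \<le> 2 * t * (g \<bullet> g) + t\<^sup>2 * h" for t
  proof -
    have "x + t *\<^sub>R g \<in> S"
      using S x(1) gS by (simp add: subspace_add subspace_scale)
    from min[OF this] have "0 \<le> f (x + t *\<^sub>R g) \<bullet> (x + t *\<^sub>R g) - l * ((x + t *\<^sub>R g) \<bullet> (x + t *\<^sub>R g))"
      by simp
    also have "\<dots> = 2 * t * (f x \<bullet> g - l * (x \<bullet> g)) + t\<^sup>2 * h"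
      using x(2) sym[of g x]
      by (simp add: linear_add[OF f] linear_scale[OF f] inner_add inner_commute h_def
          power2_eq_square algebra_simps)
    also have "f x \<bullet> g - l * (x \<bullet> g) = g \<bullet> g"
      by (simp add: g_def inner_diff_left)
    finally show ?thesis .
  qed
  \<comment> \<open>Small enough that the quadratic term is at most half of the linear one.\<close>
  define t where "t = - (g \<bullet> g) / (\<bar>h\<bar> + 1)"
  have "t < 0"
    using pos by (simp add: t_def divide_neg_pos)
  have "2 * t * (g \<bullet> g) + t\<^sup>2 * h = t * (2 * (g \<bullet> g) + t * h)"
    by (simp add: power2_eq_square algebra_simps)
  moreover have "\<bar>t * h\<bar> \<le> g \<bullet> g"
  proof -
    have "\<bar>t * h\<bar> = (g \<bullet> g) * (\<bar>h\<bar> / (\<bar>h\<bar> + 1))"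
      using pos by (simp add: t_def abs_mult)
    also have "\<dots> \<le> (g \<bullet> g) * 1"
      using pos by (intro mult_left_mono) auto
    finally show ?thesis by simp
  qed
  then have "2 * (g \<bullet> g) + t * h > 0"
    using pos by linarith
  ultimately show False
    using q[of t] \<open>t < 0\<close> by (smt (verit) mult_neg_pos)
qed

text \<open>
  Each new eigenvector minimizes the Rayleigh quotient on the orthogonal complement of the earlier
  ones. The last conjunct records that the values found so far bound the form from below on the
  remaining complement; it is what makes the eigenvalues come out in increasing order.
\<close>

lemma exists_lowest_eigenvectors:
  fixes f :: "'a::euclidean_space \<Rightarrow> 'a"
  assumes f: "linear f" and sym: "\<And>x y. f x \<bullet> y = x \<bullet> f y"
    and "k \<le> DIM('a)"
  shows "\<exists>e q. orthonormal_upto k e \<and> (\<forall>j<k. f (e j) = q j *\<^sub>R e j) \<and>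
     (\<forall>i j. i \<le> j \<longrightarrow> j < k \<longrightarrow> q i \<le> q j) \<and>
     (\<forall>x. (\<forall>j<k. x \<bullet> e j = 0) \<longrightarrow> (\<forall>j<k. q j * (x \<bullet> x) \<le> f x \<bullet> x))"
  using assms(3)
proof (induction k)
  case 0
  show ?case
    by (simp add: orthonormal_upto_def)
next
  case (Suc k)
  then obtain e q where on: "orthonormal_upto k e"
    and ev: "\<And>j. j < k \<Longrightarrow> f (e j) = q j *\<^sub>R e j"
    and mono: "\<And>i j. i \<le> j \<Longrightarrow> j < k \<Longrightarrow> q i \<le> q j"
    and low: "\<And>x j. (\<forall>j<k. x \<bullet> e j = 0) \<Longrightarrow> j < k \<Longrightarrow> q j * (x \<bullet> x) \<le> f x \<bullet> x"
    by (metis Suc_leD)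
  define S where "S = {x. \<forall>j<k. x \<bullet> e j = 0}"
  have S: "subspace S"
    by (auto simp: S_def subspace_def inner_add_left)
  have inv: "f x \<in> S" if "x \<in> S" for x
    using that by (auto simp: S_def sym ev)
  have "S = (\<Inter>j\<in>{..<k}. {x. x \<bullet> e j = 0})"
    by (auto simp: S_def)
  then have "closed S"
    by (simp add: closed_INT closed_Collect_eq continuous_on_inner)
  then have "compact (sphere 0 1 \<inter> S)"
    by (simp add: compact_Int_closed)
  moreover have "sphere 0 1 \<inter> S \<noteq> {}"
  proof -
    have "card (e ` {..<k}) < DIM('a)"
      using card_image_le[of "{..<k}" e] Suc.prems by simp
    then obtain w where w: "w \<noteq> 0" "\<And>s. s \<in> e ` {..<k} \<Longrightarrow> s \<bullet> w = 0"
      by (rule exists_orthogonal_to_few[rotated]) auto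
    have "w \<bullet> e j = 0" if "j < k" for j
      using w(2)[of "e j"] that by (simp add: inner_commute)
    then have "sgn w \<in> sphere 0 1 \<inter> S"
      using w(1) by (auto simp: S_def norm_sgn sgn_div_norm)
    then show ?thesis by blast
  qed
  moreover have "continuous_on (sphere 0 1 \<inter> S) (\<lambda>x. f x \<bullet> x)"
    using f by (intro continuous_intros linear_continuous_on) (simp add: linear_conv_bounded_linear)
  ultimately obtain x where x: "norm x = 1" "x \<in> S"
    and xmin: "\<And>y. norm y = 1 \<Longrightarrow> y \<in> S \<Longrightarrow> f x \<bullet> x \<le> f y \<bullet> y"
    using continuous_attains_inf[of "sphere 0 1 \<inter> S" "\<lambda>x. f x \<bullet> x"]
    by (metis Int_iff mem_sphere_0)
  define l where "l = f x \<bullet> x"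
  have xx: "x \<bullet> x = 1"
    using x(1) by (simp add: norm_eq_1)
  have min: "l * (y \<bullet> y) \<le> f y \<bullet> y" if "y \<in> S" for y
  proof (cases "y = 0")
    case True
    then show ?thesis by simp
  next
    case False
    have "sgn y \<in> S"
      using S that by (simp add: sgn_div_norm subspace_scale)
    with False have "l \<le> f (sgn y) \<bullet> sgn y"
      unfolding l_def by (intro xmin) (auto simp: norm_sgn)
    also have "\<dots> = (f y \<bullet> y) / (y \<bullet> y)"
      by (simp add: sgn_div_norm linear_scale[OF f] dot_square_norm power2_eq_square divide_simps)
    finally show ?thesis
      using False by (simp add: pos_le_divide_eq)
  qed
  have fx: "f x = l *\<^sub>R x"
    using minimizer_is_eigenvector[OF f sym S inv x(2) _ min] xx by (simp add: l_def)
  have below: "q j \<le> l" if "j < k" for j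
    using low[of x j] x(2) that xx by (simp add: S_def l_def)
  let ?e = "e(k := x)" and ?q = "q(k := l)"
  have "orthonormal_upto (Suc k) ?e"
    using on x(2) xx by (auto simp: orthonormal_upto_def less_Suc_eq S_def inner_commute)
  moreover have "\<forall>j<Suc k. f (?e j) = ?q j *\<^sub>R ?e j"
    using ev fx by (auto simp: less_Suc_eq)
  moreover have "\<forall>i j. i \<le> j \<longrightarrow> j < Suc k \<longrightarrow> ?q i \<le> ?q j"
    using mono below by (auto simp: less_Suc_eq)
  moreover have "?q j * (y \<bullet> y) \<le> f y \<bullet> y"
    if "\<forall>j<Suc k. y \<bullet> ?e j = 0" "j < Suc k" for y j
  proof -
    have y: "\<forall>j<k. y \<bullet> e j = 0"
      using that(1) by (auto simp: less_Suc_eq split: if_splits)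
    then show ?thesis
      using low[OF y] min[of y] that(2) by (auto simp: S_def less_Suc_eq)
  qed
  ultimately show ?case by blast
qed

theorem spectral_theorem_ordered:
  fixes f :: "'a::euclidean_space \<Rightarrow> 'a"
  assumes "linear f" "\<And>x y. f x \<bullet> y = x \<bullet> f y"
  obtains e q where "orthonormal_upto DIM('a) e"
    and "\<And>j. j < DIM('a) \<Longrightarrow> f (e j) = q j *\<^sub>R e j"
    and "\<And>i j. i \<le> j \<Longrightarrow> j < DIM('a) \<Longrightarrow> q i \<le> q j"
  using exists_lowest_eigenvectors[OF assms order_refl] by blast

section \<open>Extreme points of symmetric slab intersections\<close>

text \<open>
  A strict sublevel set of a convex function is convex, so if it contained all extreme points of
  \<open>C\<close> it would contain \<open>C\<close> by the Krein-Milman theorem.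
\<close>

lemma convex_fun_exceeded_at_extreme_point:
  fixes C :: "'a::euclidean_space set"
  assumes "compact C" "convex C" "convex_on UNIV \<phi>" "y \<in> C"
  obtains z where "z extreme_point_of C" "\<phi> y \<le> \<phi> z"
proof (rule ccontr)
  assume "\<not> thesis"
  then have *: "\<phi> z < \<phi> y" if "z extreme_point_of C" for z
    using that \<open>\<And>z. z extreme_point_of C \<Longrightarrow> \<phi> y \<le> \<phi> z \<Longrightarrow> thesis\<close> by fastforce
  have "convex {x. \<phi> x < \<phi> y}"
  proof (rule convexI)
    fix a b :: 'a and s t :: real
    assume ab: "a \<in> {x. \<phi> x < \<phi> y}" "b \<in> {x. \<phi> x < \<phi> y}" and st: "0 \<le> s" "0 \<le> t" "s + t = 1"
    have "\<phi> (s *\<^sub>R a + t *\<^sub>R b) \<le> s * \<phi> a + t * \<phi> b"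
      using assms(3) st by (auto simp: convex_on_def)
    also have "\<dots> < \<phi> y"
      using convex_bound_lt[of "\<phi> a" "\<phi> y" "\<phi> b" s t] ab st by simp
    finally show "s *\<^sub>R a + t *\<^sub>R b \<in> {x. \<phi> x < \<phi> y}" by simp
  qed
  then have "convex hull {z. z extreme_point_of C} \<subseteq> {x. \<phi> x < \<phi> y}"
    using * by (intro hull_minimal) auto
  then show False
    using Krein_Milman_Minkowski[OF assms(1,2)] assms(4) by auto
qed

text \<open>
  With fewer tight constraints there is a direction orthogonal to all of them and to all \<open>e j\<close>;
  a small move both ways along it stays in the set, so \<open>z\<close> is the midpoint of a segment.
  The equations \<open>z \<bullet> e j = 0\<close> cut the section by a subspace out of the intersection of slabs.
\<close>

lemma extreme_point_many_tight_slabs: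
  fixes v :: "'i \<Rightarrow> 'a::euclidean_space"
  assumes "finite I" "finite J"
    and z: "z extreme_point_of {z. (\<forall>i\<in>I. \<bar>v i \<bullet> z\<bar> \<le> 1) \<and> (\<forall>j\<in>J. z \<bullet> e j = 0)}"
  shows "DIM('a) \<le> card {i\<in>I. \<bar>v i \<bullet> z\<bar> = 1} + card J"
proof (rule ccontr)
  define C where "C = {z. (\<forall>i\<in>I. \<bar>v i \<bullet> z\<bar> \<le> 1) \<and> (\<forall>j\<in>J. z \<bullet> e j = 0)}"
  define T where "T = {i\<in>I. \<bar>v i \<bullet> z\<bar> = 1}"
  have zC: "z \<in> C"
    using z by (simp add: C_def extreme_point_of_def)
  assume "\<not> ?thesis"
  then have "card T + card J < DIM('a)"
    by (simp add: T_def)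
  moreover have "finite T"
    using assms(1) by (simp add: T_def)
  ultimately have "card (v ` T \<union> e ` J) < DIM('a)"
    by (meson add_mono assms(2) card_Un_le card_image_le le_less_trans order_trans)
  then obtain w where w: "w \<noteq> 0" "\<And>s. s \<in> v ` T \<union> e ` J \<Longrightarrow> s \<bullet> w = 0"
    using exists_orthogonal_to_few[of "v ` T \<union> e ` J"] \<open>finite T\<close> assms(2) by blast
  have "\<forall>\<^sub>F t in at_right 0. \<forall>i\<in>I. \<bar>v i \<bullet> (z + t *\<^sub>R w)\<bar> \<le> 1 \<and> \<bar>v i \<bullet> (z - t *\<^sub>R w)\<bar> \<le> 1"
  proof (rule eventually_ball_finite[OF assms(1)], rule ballI)
    fix i assume i: "i \<in> I"
    show "\<forall>\<^sub>F t in at_right 0. \<bar>v i \<bullet> (z + t *\<^sub>R w)\<bar> \<le> 1 \<and> \<bar>v i \<bullet> (z - t *\<^sub>R w)\<bar> \<le> 1"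
    proof (cases "i \<in> T")
      case True
      then have "v i \<bullet> w = 0" using w(2) by blast
      then show ?thesis
        using zC i by (simp add: C_def inner_add_right inner_diff_right)
    next
      case False
      then have lt: "\<bar>v i \<bullet> z\<bar> < 1"
        using zC i by (force simp: C_def T_def)
      have "((\<lambda>t. \<bar>v i \<bullet> (z + t *\<^sub>R w)\<bar>) \<longlongrightarrow> \<bar>v i \<bullet> (z + 0 *\<^sub>R w)\<bar>) (at_right 0)"
           "((\<lambda>t. \<bar>v i \<bullet> (z - t *\<^sub>R w)\<bar>) \<longlongrightarrow> \<bar>v i \<bullet> (z - 0 *\<^sub>R w)\<bar>) (at_right 0)"
        by (intro tendsto_intros)+
      then have "\<forall>\<^sub>F t in at_right 0. \<bar>v i \<bullet> (z + t *\<^sub>R w)\<bar> < 1"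
                "\<forall>\<^sub>F t in at_right 0. \<bar>v i \<bullet> (z - t *\<^sub>R w)\<bar> < 1"
        using lt by (auto dest: order_tendstoD(2)[where a = 1])
      then show ?thesis
        by eventually_elim auto
    qed
  qed
  moreover have "\<forall>\<^sub>F t in at_right (0::real). t > 0"
    by (simp add: eventually_at_right_less)
  ultimately have "\<forall>\<^sub>F t in at_right 0. (\<forall>i\<in>I. \<bar>v i \<bullet> (z + t *\<^sub>R w)\<bar> \<le> 1 \<and> \<bar>v i \<bullet> (z - t *\<^sub>R w)\<bar> \<le> 1) \<and> t > 0"
    by eventually_elim auto
  then obtain t where t: "t > 0"
    "\<forall>i\<in>I. \<bar>v i \<bullet> (z + t *\<^sub>R w)\<bar> \<le> 1 \<and> \<bar>v i \<bullet> (z - t *\<^sub>R w)\<bar> \<le> 1"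
    using eventually_happens'[of "at_right (0::real)"] by auto
  have "w \<bullet> e j = 0" if "j \<in> J" for j
    using w(2)[of "e j"] that by (simp add: inner_commute)
  then have in_C: "z + t *\<^sub>R w \<in> C" "z - t *\<^sub>R w \<in> C"
    using t(2) zC by (auto simp: C_def inner_add_left inner_diff_left)
  have "z - t *\<^sub>R w \<noteq> z + t *\<^sub>R w"
    using t(1) w(1) by (auto simp: algebra_simps simp flip: scaleR_left.add)
  moreover have "midpoint (z - t *\<^sub>R w) (z + t *\<^sub>R w) = z"
    by (simp add: midpoint_def scaleR_2[symmetric])
  ultimately have "z \<in> open_segment (z - t *\<^sub>R w) (z + t *\<^sub>R w)"
    using midpoint_in_open_segment by metis
  then show False
    using z in_C by (auto simp: extreme_point_of_def C_def)
qed

section \<open>Sections of the cube dominate the identity\<close>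

lemma convex_on_weighted_square_sum:
  assumes "\<And>j. j \<in> J \<Longrightarrow> 0 \<le> c j"
  shows "convex_on UNIV (\<lambda>x::'a::real_inner. \<Sum>j\<in>J. c j * (x \<bullet> e j)\<^sup>2)"
proof (rule convex_onI)
  fix t :: real and x y :: 'a
  assume t: "0 < t" "t < 1"
  have "(((1 - t) *\<^sub>R x + t *\<^sub>R y) \<bullet> b)\<^sup>2 \<le> (1 - t) * (x \<bullet> b)\<^sup>2 + t * (y \<bullet> b)\<^sup>2" for b
  proof -
    have "(1 - t) * (x \<bullet> b)\<^sup>2 + t * (y \<bullet> b)\<^sup>2 - (((1 - t) *\<^sub>R x + t *\<^sub>R y) \<bullet> b)\<^sup>2
        = t * (1 - t) * (x \<bullet> b - y \<bullet> b)\<^sup>2"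
      by (simp add: inner_add_left power2_eq_square algebra_simps)
    moreover have "\<dots> \<ge> 0"
      using t by simp
    ultimately show ?thesis by linarith
  qed
  then have "(\<Sum>j\<in>J. c j * (((1 - t) *\<^sub>R x + t *\<^sub>R y) \<bullet> e j)\<^sup>2)
      \<le> (\<Sum>j\<in>J. c j * ((1 - t) * (x \<bullet> e j)\<^sup>2 + t * (y \<bullet> e j)\<^sup>2))"
    using assms by (intro sum_mono mult_left_mono) auto
  also have "\<dots> = (1 - t) * (\<Sum>j\<in>J. c j * (x \<bullet> e j)\<^sup>2) + t * (\<Sum>j\<in>J. c j * (y \<bullet> e j)\<^sup>2)"
    by (simp add: sum_distrib_left sum.distrib[symmetric] algebra_simps)
  finally show "(\<Sum>j\<in>J. c j * (((1 - t) *\<^sub>R x + t *\<^sub>R y) \<bullet> e j)\<^sup>2) \<le> \<dots>" .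
qed simp

text \<open>
  The Ball-Prodromou form of Vaaler's theorem, for the form with eigenvectors \<open>e j\<close> and eigenvalues
  \<open>\<mu> j\<close>. The eigenvalues decrease, so in the induction on \<open>k\<close> the last one is the smallest: it is
  split off as a multiple of the identity, and the rest is a form on the span of the first \<open>k - 1\<close>
  vectors. The subspace spanned by the first \<open>k\<close> vectors is described by the vanishing of the
  other coordinates.
\<close>

lemma parseval_frame_slabs:
  fixes v :: "'i \<Rightarrow> 'a::euclidean_space" and \<mu> :: "nat \<Rightarrow> real"
  assumes I: "finite I" and frame: "\<And>z. (\<Sum>i\<in>I. (v i \<bullet> z)\<^sup>2) = (norm z)\<^sup>2"
    and e: "orthonormal_upto DIM('a) e"
    and "k \<le> DIM('a)"
    and "\<And>j. j < k \<Longrightarrow> 0 \<le> \<mu> j" and "\<And>i j. i \<le> j \<Longrightarrow> j < k \<Longrightarrow> \<mu> j \<le> \<mu> i"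
  shows "\<exists>z. (\<forall>i\<in>I. \<bar>v i \<bullet> z\<bar> \<le> 1) \<and> (\<forall>j\<in>{k..<DIM('a)}. z \<bullet> e j = 0) \<and>
    (\<Sum>j<k. \<mu> j) \<le> (\<Sum>j<k. \<mu> j * (z \<bullet> e j)\<^sup>2)"
  using assms(4-6)
proof (induction k arbitrary: \<mu>)
  case 0
  show ?case
    by (intro exI[of _ 0]) auto
next
  case (Suc k)
  define C where "C = {z. (\<forall>i\<in>I. \<bar>v i \<bullet> z\<bar> \<le> 1) \<and> (\<forall>j\<in>{Suc k..<DIM('a)}. z \<bullet> e j = 0)}"
  define \<nu> where "\<nu> j = \<mu> j - \<mu> k" for j
  have \<nu>_nonneg: "0 \<le> \<nu> j" if "j < Suc k" for j
    using Suc.prems(3)[of j k] that by (simp add: \<nu>_def)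
  \<comment> \<open>The last weight of \<open>\<nu>\<close> is 0, so the induction hypothesis also treats the form on \<open>Suc k\<close> coordinates.\<close>
  obtain y where y: "\<forall>i\<in>I. \<bar>v i \<bullet> y\<bar> \<le> 1" "\<forall>j\<in>{k..<DIM('a)}. y \<bullet> e j = 0"
    and y_large: "(\<Sum>j<k. \<nu> j) \<le> (\<Sum>j<k. \<nu> j * (y \<bullet> e j)\<^sup>2)"
    using Suc.IH[of \<nu>] Suc.prems \<nu>_nonneg by (auto simp: \<nu>_def)
  have C_eq: "C = (\<Inter>i\<in>I. {z. \<bar>v i \<bullet> z\<bar> \<le> 1}) \<inter> (\<Inter>j\<in>{Suc k..<DIM('a)}. {z. z \<bullet> e j = 0})"
    by (auto simp: C_def)
  have "closed C"
    unfolding C_eq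
    by (intro closed_Int closed_INT ballI closed_Collect_le closed_Collect_eq continuous_intros)
  moreover have "bounded C"
  proof (rule boundedI)
    fix z assume "z \<in> C"
    then have "(norm z)\<^sup>2 \<le> (\<Sum>i\<in>I. 1)"
      unfolding frame[symmetric] by (intro sum_mono) (auto simp: C_def abs_square_le_1)
    then show "norm z \<le> sqrt (card I)"
      by (simp add: real_le_rsqrt)
  qed
  ultimately have "compact C"
    by (simp add: compact_eq_bounded_closed)
  moreover have "convex C"
  proof -
    have "{z. \<bar>v i \<bullet> z\<bar> \<le> 1} = {z. v i \<bullet> z \<le> 1} \<inter> {z. v i \<bullet> z \<ge> -1}" for i
      by auto
    moreover have "{z. z \<bullet> e j = 0} = {z. e j \<bullet> z = 0}" for j
      by (simp add: inner_commute)
    ultimately show ?thesis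
      unfolding C_eq
      by (auto intro!: convex_Int convex_INT convex_halfspace_le convex_halfspace_ge convex_hyperplane)
  qed
  moreover have "y \<in> C"
    using y by (simp add: C_def)
  ultimately obtain z where z: "z extreme_point_of C"
    and zy: "(\<Sum>j<Suc k. \<nu> j * (y \<bullet> e j)\<^sup>2) \<le> (\<Sum>j<Suc k. \<nu> j * (z \<bullet> e j)\<^sup>2)"
    using convex_fun_exceeded_at_extreme_point[of C "\<lambda>x. \<Sum>j<Suc k. \<nu> j * (x \<bullet> e j)\<^sup>2" y]
      convex_on_weighted_square_sum[of "{..<Suc k}" \<nu> e] \<nu>_nonneg by auto
  have zC: "z \<in> C"
    using z by (simp add: extreme_point_of_def)
  have norm_z: "(norm z)\<^sup>2 = (\<Sum>j<Suc k. (z \<bullet> e j)\<^sup>2)"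
    unfolding orthonormal_parseval[OF e]
    using zC Suc.prems(1) by (intro sum.mono_neutral_right) (auto simp: C_def)
  \<comment> \<open>Tight constraints contribute 1 each to the frame identity, hence \<open>(norm z)\<^sup>2 \<ge> k + 1\<close>.\<close>
  have "Suc k \<le> card {i\<in>I. \<bar>v i \<bullet> z\<bar> = 1}"
    using extreme_point_many_tight_slabs[OF I _ z[unfolded C_def]] Suc.prems(1) by simp
  then have "real (Suc k) \<le> (\<Sum>i\<in>{i\<in>I. \<bar>v i \<bullet> z\<bar> = 1}. 1)"
    by (simp del: of_nat_Suc)
  also have "\<dots> = (\<Sum>i\<in>{i\<in>I. \<bar>v i \<bullet> z\<bar> = 1}. (v i \<bullet> z)\<^sup>2)"
    by (intro sum.cong) (auto simp: power2_eq_1_iff abs_if split: if_splits)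
  also have "\<dots> \<le> (\<Sum>i\<in>I. (v i \<bullet> z)\<^sup>2)"
    using I by (intro sum_mono2) auto
  also have "\<dots> = (\<Sum>j<Suc k. (z \<bullet> e j)\<^sup>2)"
    by (simp add: frame norm_z)
  finally have large: "real (Suc k) \<le> (\<Sum>j<Suc k. (z \<bullet> e j)\<^sup>2)" .
  have "(\<Sum>j<Suc k. \<mu> j) = (\<Sum>j<Suc k. \<nu> j) + \<mu> k * real (Suc k)"
    by (simp add: \<nu>_def sum_subtractf algebra_simps)
  also have "\<dots> \<le> (\<Sum>j<Suc k. \<nu> j * (z \<bullet> e j)\<^sup>2) + \<mu> k * (\<Sum>j<Suc k. (z \<bullet> e j)\<^sup>2)"
  proof (rule add_mono)
    show "(\<Sum>j<Suc k. \<nu> j) \<le> (\<Sum>j<Suc k. \<nu> j * (z \<bullet> e j)\<^sup>2)"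
      using y_large zy by (simp add: \<nu>_def)
    show "\<mu> k * real (Suc k) \<le> \<mu> k * (\<Sum>j<Suc k. (z \<bullet> e j)\<^sup>2)"
      using large Suc.prems(2)[of k] by (intro mult_left_mono) auto
  qed
  also have "\<dots> = (\<Sum>j<Suc k. \<mu> j * (z \<bullet> e j)\<^sup>2)"
    unfolding sum_distrib_left sum.distrib[symmetric] by (simp add: \<nu>_def algebra_simps)
  finally have "(\<Sum>j<Suc k. \<mu> j) \<le> (\<Sum>j<Suc k. \<mu> j * (z \<bullet> e j)\<^sup>2)" .
  then show ?case
    using zC unfolding C_def by blast
qed

section \<open>Long vectors in the polar body\<close>

text \<open>
  Here \<open>f\<close> is the operator \<open>Q = \<Sum>i. u i \<otimes> u i\<close>, with eigenvalues \<open>q j\<close>, and \<open>D\<close> is \<open>Q\<^sup>-\<^sup>1\<^sup>/\<^sup>2\<close>.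
  The eigenvalues of \<open>Q\<close> increase, so those of \<open>Q\<^sup>-\<^sup>1\<close> decrease as the frame lemma requires.
  For unit vectors the sum of the squared norms is their number.
\<close>

theorem exists_long_vector_in_slabs:
  fixes u :: "'i \<Rightarrow> 'a::euclidean_space"
  assumes I: "finite I" and s: "0 < (\<Sum>i\<in>I. (norm (u i))\<^sup>2)"
  obtains y where "\<And>i. i \<in> I \<Longrightarrow> \<bar>u i \<bullet> y\<bar> \<le> 1"
    and "(real DIM('a))\<^sup>2 \<le> (\<Sum>i\<in>I. (norm (u i))\<^sup>2) * (norm y)\<^sup>2"
proof -
  let ?d = "DIM('a)"
  let ?s = "\<Sum>i\<in>I. (norm (u i))\<^sup>2"
  define f where "f x = (\<Sum>i\<in>I. (u i \<bullet> x) *\<^sub>R u i)" for x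
  have f_inner: "f x \<bullet> y = (\<Sum>i\<in>I. (u i \<bullet> x) * (u i \<bullet> y))" for x y
    by (simp add: f_def inner_sum_left)
  have lin: "linear f"
    by (rule linearI)
       (auto simp: f_def inner_add_right scaleR_add_left sum.distrib scaleR_sum_right)
  have sym: "f x \<bullet> y = x \<bullet> f y" for x y
    by (simp add: inner_commute[of x] f_inner mult.commute)
  obtain e q where e: "orthonormal_upto ?d e"
    and ev: "\<And>j. j < ?d \<Longrightarrow> f (e j) = q j *\<^sub>R e j"
    and mono: "\<And>i j. i \<le> j \<Longrightarrow> j < ?d \<Longrightarrow> q i \<le> q j"
    using spectral_theorem_ordered[OF lin sym] by blast
  have q_eq: "q j = (\<Sum>i\<in>I. (u i \<bullet> e j)\<^sup>2)" if "j < ?d" for j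
  proof -
    have "q j = f (e j) \<bullet> e j"
      using ev[OF that] orthonormal_upto_inner[OF e that that] by simp
    then show ?thesis
      by (simp add: f_inner power2_eq_square)
  qed
  have trace: "(\<Sum>j<?d. q j) = ?s"
  proof -
    have "(\<Sum>j<?d. q j) = (\<Sum>j<?d. \<Sum>i\<in>I. (u i \<bullet> e j)\<^sup>2)"
      by (simp add: q_eq)
    also have "\<dots> = ?s"
      by (subst sum.swap) (simp add: orthonormal_parseval[OF e])
    finally show ?thesis .
  qed
  show thesis
  proof (cases "\<exists>j<?d. q j = 0")
    case True
    then obtain j where j: "j < ?d" "q j = 0" by blast
    then have 0: "u i \<bullet> e j = 0" if "i \<in> I" for i
      using q_eq[OF j(1)] that I by (simp add: sum_nonneg_eq_0_iff)
    have "norm (e j) = 1"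
      using orthonormal_upto_inner[OF e j(1) j(1)] by (simp add: norm_eq_1)
    \<comment> \<open>Every multiple of \<open>e j\<close> is admissible; this one has exactly the required length.\<close>
    then show ?thesis
      using that[of "(real ?d / sqrt ?s) *\<^sub>R e j"] 0 s
      by (simp add: power_mult_distrib power_divide)
  next
    case False
    have q_pos: "0 < q j" if "j < ?d" for j
      using False that q_eq[OF that] by (metis sum_nonneg zero_le_power2 less_eq_real_def)
    define D where "D z = (\<Sum>j<?d. ((z \<bullet> e j) / sqrt (q j)) *\<^sub>R e j)" for z
    have D_coord: "D z \<bullet> e j = (z \<bullet> e j) / sqrt (q j)" if "j < ?d" for z j
      unfolding D_def by (rule inner_orthonormal_sum[OF e that])
    have D_sym: "D x \<bullet> y = x \<bullet> D y" for x y
      unfolding D_def inner_sum_left inner_sum_right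
      by (rule sum.cong) (simp_all add: inner_commute)
    have frame: "(\<Sum>i\<in>I. (D (u i) \<bullet> z)\<^sup>2) = (norm z)\<^sup>2" for z
    proof -
      have "(\<Sum>i\<in>I. (D (u i) \<bullet> z)\<^sup>2) = D z \<bullet> f (D z)"
        by (subst sym[symmetric]) (simp add: D_sym f_inner power2_eq_square)
      also have "f (D z) = (\<Sum>j<?d. ((z \<bullet> e j) / sqrt (q j)) *\<^sub>R f (e j))"
        unfolding D_def linear_sum[OF lin] linear_scale[OF lin] by (rule refl)
      also have "D z \<bullet> \<dots> = (\<Sum>j<?d. (z \<bullet> e j) / sqrt (q j) * (q j * (D z \<bullet> e j)))"
        by (auto simp: inner_sum_right ev intro!: sum.cong)
      also have "\<dots> = (\<Sum>j<?d. (z \<bullet> e j)\<^sup>2)"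
      proof (rule sum.cong)
        fix j assume "j \<in> {..<?d}"
        then have j: "j < ?d" by simp
        have "sqrt (q j) * sqrt (q j) = q j" "sqrt (q j) \<noteq> 0"
          using q_pos[OF j] by auto
        then show "(z \<bullet> e j) / sqrt (q j) * (q j * (D z \<bullet> e j)) = (z \<bullet> e j)\<^sup>2"
          unfolding D_coord[OF j] by (simp add: power2_eq_square divide_simps)
      qed simp
      finally show ?thesis
        by (simp add: orthonormal_parseval[OF e])
    qed
    have "\<exists>z. (\<forall>i\<in>I. \<bar>D (u i) \<bullet> z\<bar> \<le> 1) \<and> (\<forall>j\<in>{?d..<?d}. z \<bullet> e j = 0) \<and>
        (\<Sum>j<?d. 1 / q j) \<le> (\<Sum>j<?d. 1 / q j * (z \<bullet> e j)\<^sup>2)"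
    proof (rule parseval_frame_slabs[OF I frame e order_refl])
      show "0 \<le> 1 / q j" if "j < ?d" for j
        using q_pos[OF that] by simp
      show "1 / q j \<le> 1 / q i" if "i \<le> j" "j < ?d" for i j
        using mono[OF that] q_pos[of i] that by (intro divide_left_mono) auto
    qed
    then obtain z where z: "\<And>i. i \<in> I \<Longrightarrow> \<bar>u i \<bullet> D z\<bar> \<le> 1"
      and z_large: "(\<Sum>j<?d. 1 / q j) \<le> (\<Sum>j<?d. 1 / q j * (z \<bullet> e j)\<^sup>2)"
      by (auto simp: D_sym)
    have "(norm (D z))\<^sup>2 = (\<Sum>j<?d. 1 / q j * (z \<bullet> e j)\<^sup>2)"
      unfolding orthonormal_parseval[OF e]
      by (intro sum.cong) (auto simp: D_coord power_divide q_pos less_imp_le)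
    with z_large have norm_Dz: "(\<Sum>j<?d. 1 / q j) \<le> (norm (D z))\<^sup>2"
      by simp
    have "(real ?d)\<^sup>2 = (\<Sum>j<?d. sqrt (q j) * (1 / sqrt (q j)))\<^sup>2"
    proof -
      have "(\<Sum>j<?d. sqrt (q j) * (1 / sqrt (q j))) = (\<Sum>j<?d. 1)"
        using q_pos by (intro sum.cong) force+
      then show ?thesis
        by simp
    qed
    also have "\<dots> \<le> (\<Sum>j<?d. (sqrt (q j))\<^sup>2) * (\<Sum>j<?d. (1 / sqrt (q j))\<^sup>2)"
      by (rule Cauchy_Schwarz_ineq_sum)
    also have "\<dots> = ?s * (\<Sum>j<?d. 1 / q j)"
      using q_pos by (simp add: trace[symmetric] power_divide less_imp_le)
    also have "\<dots> \<le> ?s * (norm (D z))\<^sup>2"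
      using norm_Dz s by (intro mult_left_mono) auto
    finally show ?thesis
      using that[OF z] by blast
  qed
qed

theorem theorem2:
  fixes n :: nat and u :: "nat \<Rightarrow> real ^ 'd" and \<epsilon> :: real
  assumes "n \<ge> 1"
    and "\<And>i. i \<in> {1..n} \<Longrightarrow> norm (u i) = 1"
    and "\<epsilon> > 0"
  shows "\<not> (\<lambda>x. (sqrt (real n) / real CARD('d) + \<epsilon>) *\<^sub>R x) ` cball (0 :: real ^ 'd) 1
           \<subseteq> convex hull (\<Union>i\<in>{1..n}. {u i, - u i})"
proof
  let ?r = "sqrt (real n) / real CARD('d) + \<epsilon>"
  assume sub: "(\<lambda>x. ?r *\<^sub>R x) ` cball (0 :: real ^ 'd) 1
           \<subseteq> convex hull (\<Union>i\<in>{1..n}. {u i, - u i})"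
  have n: "(\<Sum>i\<in>{1..n}. (norm (u i))\<^sup>2) = real n"
    using assms(2) by simp
  obtain y where y: "\<And>i. i \<in> {1..n} \<Longrightarrow> \<bar>u i \<bullet> y\<bar> \<le> 1"
    and y_long: "(real CARD('d))\<^sup>2 \<le> real n * (norm y)\<^sup>2"
    using exists_long_vector_in_slabs[of "{1..n}" u] n assms(1) by auto
  have long: "real CARD('d) \<le> sqrt (real n) * norm y"
    using real_le_rsqrt[OF y_long] by (simp add: real_sqrt_mult)
  then have y_pos: "0 < norm y"
    by (cases "y = 0") auto
  have "convex hull (\<Union>i\<in>{1..n}. {u i, - u i}) \<subseteq> {x. y \<bullet> x \<le> 1}"
    using y by (intro hull_minimal convex_halfspace_le) (force simp: inner_commute abs_le_iff)
  moreover have "?r *\<^sub>R sgn y \<in> (\<lambda>x. ?r *\<^sub>R x) ` cball (0 :: real ^ 'd) 1"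
    by (auto simp: norm_sgn)
  ultimately have "y \<bullet> (?r *\<^sub>R sgn y) \<le> 1"
    using sub by blast
  moreover have "y \<bullet> sgn y = norm y"
    using y_pos by (simp add: sgn_div_norm dot_square_norm power2_eq_square)
  ultimately have "?r * norm y \<le> 1"
    by simp
  moreover have "1 \<le> sqrt (real n) / real CARD('d) * norm y"
    using long by (simp add: field_simps)
  moreover have "0 < \<epsilon> * norm y"
    using assms(3) y_pos by simp
  ultimately show False
    unfolding distrib_right by linarith
qed

end
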